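(* Let $n,N\ge 1$ be integers (not necessarily equal), $\eta,\hbar\in\mathbb{C}$, and ${\bf g}=\mathrm{diag}(g_1,\dots,g_N)\in GL(N,\mathbb{C})$. Let $M_1,\dots,M_N$ be non-negative integers with $M_1+\dots+M_N=n$. Let $|\Phi\rangle=\sum_J\Phi_J|J\rangle$ be any solution, with values in the weight subspace ${\cal V}(\{M_a\})\subset(\mathbb{C}^N)^{\otimes n}$, of the rational quantum Knizhnik-Zamolodchikov (qKZ) equations $$e^{\eta\hbar\partial_{x_i}}|\Phi\rangle={\bf K}_i^{(\hbar)}|\Phi\rangle,\qquad i=1,\dots,n.$$ Then the function $\Psi=\sum_J\Phi_J$ satisfies $$\sum_{i=1}^n\Bigl(\prod_{j\ne i}\frac{x_i-x_j+\eta}{x_i-x_j}\Bigr)\Psi(x_1,\dots,x_i+\eta\hbar,\dots,x_n)=E\,\Psi(x_1,\dots,x_n),\qquad E=\sum_{a=1}^N M_a g_a .$$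
   Context: Let $V=\mathbb{C}^N$ with standard basis $e_1,\dots,e_N$, and ${\cal V}=V^{\otimes n}$. For $1\le i\neq j\le n$, ${\bf P}_{ij}$ is the operator on ${\cal V}$ permuting the $i$-th and $j$-th tensor factors, ${\bf I}$ is the identity, and ${\bf g}^{(i)}$ acts as ${\bf g}$ on the $i$-th factor and identically on all other factors. The rational $R$-matrix is $${\bf R}_{ij}(x)=\frac{x{\bf I}+\eta{\bf P}_{ij}}{x+\eta}.$$ The qKZ operators are, for $i=1,\dots,n$, $${\bf K}_i^{(\hbar)}={\bf R}_{i\,i-1}(x_i-x_{i-1}+\eta\hbar)\cdots{\bf R}_{i1}(x_i-x_1+\eta\hbar)\,{\bf g}^{(i)}\,{\bf R}_{in}(x_i-x_n)\cdots{\bf R}_{i\,i+1}(x_i-x_{i+1}),$$ where the product to the left of ${\bf g}^{(i)}$ has second indices decreasing from $i-1$ to $1$ (empty for $i=1$) and the product to the right has second indices decreasing from $n$ to $i+1$ (empty for $i=n$). The operator $e^{\eta\hbar\partial_{x_i}}$ is the shift $(e^{\eta\hbar\partial_{x_i}}f)(x_1,\dots,x_n)=f(x_1,\dots,x_i+\eta\hbar,\dots,x_n)$. Weight subspaces: ${\cal V}(\{M_a\})$ is the span of the vectors $|J\rangle=e_{j_1}\otimes\dots\otimes e_{j_n}$ over all multi-indices $J=(j_1,\dots,j_n)\in\{1,\dots,N\}^n$ in which the value $a$ occurs exactly $M_a$ times, for every $a=1,\dots,N$. Sums over $J$ are over these multi-indices. Domain convention: $\Phi_J$ are complex-valued functions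 on a set $X\subset\mathbb{C}^n$ that is mapped to itself by each shift $x_i\mapsto x_i+\eta\hbar$ and on which the points are in general position, i.e. $x_i\ne x_j$ and $x_i\neq x_j\pm\eta$ for all $i\ne j$. All equations are understood to hold at every point of $X$. *)

theory Defs
  imports "HOL-Analysis.Analysis"
begin

text \<open>
  The type \<open>'N\<close> indexes the standard basis of \<open>V\<close>, and the linearly ordered type \<open>'n\<close> indexes
  the tensor factors and the variables \<open>x\<^sub>i\<close>; the order of \<open>'n\<close> matters only for the order of
  the factors in the qKZ operators. A multi-index is a function \<open>J :: 'n \<Rightarrow> 'N\<close>, and
  the \<open>n\<close>-fold tensor power of \<open>V\<close> is the coordinate space over the multi-indices:
  \<open>v $ J\<close> is the coefficient of \<open>|J\<rangle>\<close> in \<open>v\<close>.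
\<close>

type_synonym ('N, 'n) tensor = "(complex, 'n \<Rightarrow> 'N) vec"

definition ket :: "('n::finite \<Rightarrow> 'N::finite) \<Rightarrow> ('N, 'n) tensor"
  where "ket J = axis J 1"

definition perm_op :: "'n \<Rightarrow> 'n \<Rightarrow> ('N::finite, 'n::finite) tensor \<Rightarrow> ('N, 'n) tensor"
  where "perm_op i j v = (\<chi> J. v $ (J \<circ> Transposition.transpose i j))"

definition site_op ::
    "complex ^ 'N ^ 'N \<Rightarrow> 'n \<Rightarrow> ('N::finite, 'n::finite) tensor \<Rightarrow> ('N, 'n) tensor"
  where "site_op A i v = (\<chi> J. \<Sum>b\<in>UNIV. A $ J i $ b * v $ (J(i := b)))"

lemma perm_op_ket: "perm_op i j (ket J) = ket (J \<circ> Transposition.transpose i j)"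
proof -
  have "K \<circ> Transposition.transpose i j = J \<longleftrightarrow> K = J \<circ> Transposition.transpose i j" for K
    by (metis comp_assoc comp_id transpose_comp_involutory)
  then show ?thesis
    by (simp add: perm_op_def ket_def axis_def vec_eq_iff)
qed

lemma site_op_ket: "site_op A i (ket J) = (\<Sum>a\<in>UNIV. (A $ a $ J i) *s ket (J(i := a)))"
proof -
  have "site_op A i (ket J) $ K = (\<Sum>a\<in>UNIV. (A $ a $ J i) *s ket (J(i := a))) $ K" for K
  proof (cases "\<forall>k. k \<noteq> i \<longrightarrow> K k = J k")
    case True
    then have "K(i := b) = J \<longleftrightarrow> b = J i" "K = J(i := b) \<longleftrightarrow> b = K i" for b
      by (auto simp: fun_eq_iff)
    then show ?thesis
      by (simp add: site_op_def ket_def axis_def if_distrib[where f = "\<lambda>z. _ * z"] cong: if_cong)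
  next
    case False
    then have "K(i := b) \<noteq> J" "K \<noteq> J(i := b)" for b
      by (auto simp: fun_eq_iff)
    then show ?thesis
      by (simp add: site_op_def ket_def axis_def)
  qed
  then show ?thesis
    by (simp add: vec_eq_iff)
qed

definition R_op :: "complex \<Rightarrow> 'n \<Rightarrow> 'n \<Rightarrow> complex
    \<Rightarrow> ('N::finite, 'n::finite) tensor \<Rightarrow> ('N, 'n) tensor"
  where "R_op \<eta> i j x v = (1 / (x + \<eta>)) *s (x *s v + \<eta> *s perm_op i j v)"

text \<open>The head of the list is the leftmost factor, so it is applied last.\<close>

definition op_prod :: "('v \<Rightarrow> 'v) list \<Rightarrow> 'v \<Rightarrow> 'v"
  where "op_prod fs = foldr (\<circ>) fs id"

definition qKZ_op :: "complex \<Rightarrow> complex \<Rightarrow> complex ^ 'N ^ 'N \<Rightarrow> 'n \<Rightarrow> (complex, 'n) vec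
    \<Rightarrow> ('N::finite, 'n::{finite,linorder}) tensor \<Rightarrow> ('N, 'n) tensor"
  where "qKZ_op \<eta> h A i x =
    op_prod (map (\<lambda>j. R_op \<eta> i j (x $ i - x $ j + \<eta> * h)) (rev (sorted_list_of_set {..<i})))
    \<circ> site_op A i
    \<circ> op_prod (map (\<lambda>j. R_op \<eta> i j (x $ i - x $ j)) (rev (sorted_list_of_set {i<..})))"

definition diag_matrix :: "('N \<Rightarrow> complex) \<Rightarrow> complex ^ 'N ^ 'N"
  where "diag_matrix g = (\<chi> a b. if a = b then g a else 0)"

definition shift :: "complex \<Rightarrow> 'n \<Rightarrow> complex ^ 'n \<Rightarrow> complex ^ 'n"
  where "shift c i x = (\<chi> j. if j = i then x $ j + c else x $ j)"

definition multi_indices :: "('N \<Rightarrow> nat) \<Rightarrow> ('n::finite \<Rightarrow> 'N::finite) set"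
  where "multi_indices M = {J. \<forall>a. card {i. J i = a} = M a}"

definition weight_space :: "('N \<Rightarrow> nat) \<Rightarrow> ('N::finite, 'n::finite) tensor set"
  where "weight_space M = vec.span (ket ` multi_indices M)"

definition general_position :: "complex \<Rightarrow> complex ^ 'n \<Rightarrow> bool"
  where "general_position \<eta> x \<longleftrightarrow>
    (\<forall>i j. i \<noteq> j \<longrightarrow> x $ i \<noteq> x $ j \<and> x $ i \<noteq> x $ j + \<eta> \<and> x $ i \<noteq> x $ j - \<eta>)"

definition qKZ_solution :: "complex \<Rightarrow> complex \<Rightarrow> complex ^ 'N ^ 'N \<Rightarrow> (complex, 'n) vec set
    \<Rightarrow> ((complex, 'n) vec \<Rightarrow> ('N::finite, 'n::{finite,linorder}) tensor) \<Rightarrow> bool"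
  where "qKZ_solution \<eta> h A X \<Phi> \<longleftrightarrow>
    (\<forall>x\<in>X. \<forall>i. \<Phi> (shift (\<eta> * h) i x) = qKZ_op \<eta> h A i x (\<Phi> x))"

end

(* The sum of all coefficients is a functional fixed by every permutation operator, hence by every
   R-matrix, so Psi(shift_i x) only sees the factor g^(i) R_in ... R_i,i+1. Moving that functional
   through the R-matrices keeps it in the span of the functionals omega_k = (sum of coefficients)
   o g^(k), and the total coefficient of omega_k in the sum over i is 1 by the partial fraction
   expansion of prod_{j<k} (1 + eta / (x_k - x_j)). On a weight vector the sum of the omega_k is E
   times the sum of the coefficients. *)
theory Submission
  imports Defs
begin

section \<open>Partial fractions of a product with simple poles\<close>

text \<open>As a rational function of \<open>y\<close>, the product tends to 1 at infinity and has
  simple poles at the distinct points \<open>x i\<close>, with residue \<open>c\<close> times the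
  other factors at \<open>y = x i\<close>. The induction on \<open>S\<close> keeps \<open>y\<close>
  arbitrary because the hypothesis is used at two points.\<close>

lemma prod_one_plus_inverse_partial_fractions:
  fixes c y :: "'a::field" and x :: "'i \<Rightarrow> 'a"
  assumes "finite S" "inj_on x S" "y \<notin> x ` S"
  shows "(\<Prod>j\<in>S. 1 + c / (y - x j))
    = 1 + (\<Sum>i\<in>S. c / (y - x i) * (\<Prod>j\<in>S - {i}. 1 + c / (x i - x j)))"
  using assms
proof (induction S arbitrary: y rule: finite_induct)
  case empty
  then show ?case by simp
next
  case (insert s S)
  \<comment> \<open>The residue at \<open>x i\<close> of the product over the smaller set
    \<open>S\<close>; it does not depend on \<open>y\<close>.\<close>
  define d where "d i = c * (\<Prod>j\<in>S - {i}. 1 + c / (x i - x j))" for i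
  have ne: "y \<noteq> x s" "\<And>i. i \<in> S \<Longrightarrow> y \<noteq> x i" "\<And>i. i \<in> S \<Longrightarrow> x i \<noteq> x s"
    using insert.prems insert.hyps by (auto simp: inj_on_def)
  have IH: "(\<Prod>j\<in>S. 1 + c / (z - x j)) = 1 + (\<Sum>i\<in>S. d i / (z - x i))" if "z \<notin> x ` S" for z
    using insert.IH[of z] insert.prems(1) that by (simp add: d_def)
  have remove: "(\<Prod>j\<in>insert s S - {i}. 1 + c / (x i - x j))
      = (1 + c / (x i - x s)) * (\<Prod>j\<in>S - {i}. 1 + c / (x i - x j))" if "i \<in> S" for i
    using that insert.hyps by (auto simp: insert_Diff_if)
  \<comment> \<open>From 1/((y - x_s)(y - x_i)) = (1/(y - x_i) - 1/(y - x_s)) / (x_i - x_s): the new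
    factor updates the residue at \<open>x i\<close> and contributes to the pole at
    \<open>x s\<close>.\<close>
  have split: "(1 + c / (y - x s)) * (d i / (y - x i))
      = d i / (y - x i) * (1 + c / (x i - x s)) + c / (y - x s) * (d i / (x s - x i))"
    if "i \<in> S" for i
  proof -
    have *: "y - x s \<noteq> 0" "y - x i \<noteq> 0" "x i - x s \<noteq> 0"
      using ne that by auto
    have minus: "d i / (x s - x i) = - (d i / (x i - x s))"
      by (metis minus_diff_eq minus_divide_right)
    show ?thesis
      unfolding minus using * by (simp add: divide_simps) (simp add: algebra_simps)
  qed
  have "(\<Prod>j\<in>insert s S. 1 + c / (y - x j))
      = (1 + c / (y - x s)) * (1 + (\<Sum>i\<in>S. d i / (y - x i)))"
    using insert.hyps insert.prems by (simp add: IH)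
  also have "\<dots> = 1 + c / (y - x s)
      + (\<Sum>i\<in>S. (1 + c / (y - x s)) * (d i / (y - x i)))"
    by (simp only: distrib_left mult_1_right sum_distrib_left)
  also have "\<dots> = 1 + c / (y - x s) + ((\<Sum>i\<in>S. d i / (y - x i) * (1 + c / (x i - x s)))
      + c / (y - x s) * (\<Sum>i\<in>S. d i / (x s - x i)))"
    by (simp only: split sum.distrib sum_distrib_left cong: sum.cong)
  also have "\<dots> = 1 + c / (y - x s) * (1 + (\<Sum>i\<in>S. d i / (x s - x i)))
      + (\<Sum>i\<in>S. d i / (y - x i) * (1 + c / (x i - x s)))"
    by (simp add: distrib_left)
  also have "1 + (\<Sum>i\<in>S. d i / (x s - x i)) = (\<Prod>j\<in>insert s S - {s}. 1 + c / (x s - x j))"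
    using insert.hyps ne(3) by (subst IH[symmetric]) force+
  also have "(\<Sum>i\<in>S. d i / (y - x i) * (1 + c / (x i - x s)))
      = (\<Sum>i\<in>S. c / (y - x i) * (\<Prod>j\<in>insert s S - {i}. 1 + c / (x i - x j)))"
    by (intro sum.cong refl) (simp add: remove d_def)
  finally show ?case
    using insert.hyps by (simp add: add.assoc)
qed

section \<open>The coefficient-sum functional and R-matrices\<close>

text \<open>The pairing with the n-fold tensor power of the covector (1,...,1). It ranges over all
  multi-indices, so it does not depend on the weight subspace.\<close>

definition coeff_sum :: "('N::finite, 'n::finite) tensor \<Rightarrow> complex"
  where "coeff_sum v = (\<Sum>J\<in>UNIV. v $ J)"

lemma coeff_sum_add: "coeff_sum (v + w) = coeff_sum v + coeff_sum w"
  by (simp add: coeff_sum_def sum.distrib)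

lemma coeff_sum_scale: "coeff_sum (c *s v) = c * coeff_sum v"
  by (simp add: coeff_sum_def sum_distrib_left)

lemma coeff_sum_perm_op: "coeff_sum (perm_op i j v) = coeff_sum v"
proof -
  let ?f = "\<lambda>J. J \<circ> Transposition.transpose i j"
  have "coeff_sum (perm_op i j v) = (\<Sum>J\<in>UNIV. v $ ?f J)"
    by (simp add: coeff_sum_def perm_op_def)
  also have "\<dots> = (\<Sum>J\<in>UNIV. v $ J)"
    by (rule sum.reindex_bij_witness[of _ ?f ?f]) (auto simp: comp_assoc)
  finally show ?thesis
    by (simp add: coeff_sum_def)
qed

text \<open>Permutations fix \<open>coeff_sum\<close>, so the numerator of R contributes the scalar
  \<open>x + \<eta>\<close>, which the normalisation cancels.\<close>

lemma coeff_sum_R_op: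
  assumes "x + \<eta> \<noteq> 0"
  shows "coeff_sum (R_op \<eta> i j x v) = coeff_sum v"
proof -
  have "coeff_sum (R_op \<eta> i j x v) = (x * coeff_sum v + \<eta> * coeff_sum v) / (x + \<eta>)"
    by (simp add: R_op_def coeff_sum_add coeff_sum_scale coeff_sum_perm_op add_divide_distrib)
  also have "\<dots> = coeff_sum v"
    using assms by (simp flip: distrib_right)
  finally show ?thesis .
qed

lemma op_prod_Nil [simp]: "op_prod [] = id"
  by (simp add: op_prod_def)

lemma op_prod_Cons [simp]: "op_prod (f # fs) = f \<circ> op_prod fs"
  by (simp add: op_prod_def)

lemma op_prod_snoc: "op_prod (fs @ [f]) = op_prod fs \<circ> f"
  by (induction fs) (auto simp: comp_assoc)

lemma coeff_sum_op_prod_R_op: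
  assumes "\<And>j. j \<in> set js \<Longrightarrow> y j + \<eta> \<noteq> 0"
  shows "coeff_sum (op_prod (map (\<lambda>j. R_op \<eta> i j (y j)) js) v) = coeff_sum v"
  using assms by (induction js) (auto simp: coeff_sum_R_op)

section \<open>Moving the functionals omega_k through R-matrices\<close>

lemma site_op_add: "site_op A i (v + w) = site_op A i v + site_op A i w"
  by (simp add: site_op_def vec_eq_iff distrib_left sum.distrib)

lemma site_op_scale: "site_op A i (c *s v) = c *s site_op A i v"
  by (simp add: site_op_def vec_eq_iff sum_distrib_left mult.left_commute)

lemma site_op_perm_op:
  "site_op A m (perm_op i j v) = perm_op i j (site_op A (Transposition.transpose i j m) v)"
proof -
  let ?\<tau> = "Transposition.transpose i j"
  have "J(m := b) \<circ> ?\<tau> = (J \<circ> ?\<tau>)(?\<tau> m := b)" for J :: "'a \<Rightarrow> 'b" and b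
    by (rule ext) (metis comp_apply fun_upd_apply transpose_involutory)
  then show ?thesis
    by (simp add: site_op_def perm_op_def vec_eq_iff)
qed

text \<open>The prefactor is \<open>(x + \<eta>) / x\<close>, the inverse of the coefficient of the
  identity in R. The identity part leaves the site \<open>m\<close> alone, and the permutation part
  moves it to its transposed site before being absorbed by \<open>coeff_sum\<close>.\<close>

lemma coeff_sum_site_op_R_op:
  assumes "x \<noteq> 0" "x + \<eta> \<noteq> 0"
  shows "(1 + \<eta> / x) * coeff_sum (site_op A m (R_op \<eta> i j x v))
    = coeff_sum (site_op A m v)
      + \<eta> / x * coeff_sum (site_op A (Transposition.transpose i j m) v)"
proof -
  have "coeff_sum (site_op A m (R_op \<eta> i j x v))
    = (x * coeff_sum (site_op A m v)
        + \<eta> * coeff_sum (site_op A (Transposition.transpose i j m) v)) / (x + \<eta>)"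
    by (simp add: R_op_def site_op_add site_op_scale site_op_perm_op coeff_sum_add
        coeff_sum_scale coeff_sum_perm_op add_divide_distrib)
  moreover have "1 + \<eta> / x = (x + \<eta>) / x"
    using assms by (simp add: add_divide_distrib)
  ultimately have "(1 + \<eta> / x) * coeff_sum (site_op A m (R_op \<eta> i j x v))
    = (x * coeff_sum (site_op A m v)
        + \<eta> * coeff_sum (site_op A (Transposition.transpose i j m) v)) / x"
    using assms(2) by simp
  then show ?thesis
    using assms(1) by (simp add: add_divide_distrib)
qed

text \<open>Read from left to right, each R_ij turns omega_i into a combination of omega_i and
  omega_j. Once omega_k has arisen at the factor R_ik, the remaining R_im with m < k fix it, so
  their clearing factors \<open>1 + \<eta> / y m\<close> stay behind. The head of \<open>js\<close>
  is the rightmost factor and acts first, so the induction needs arbitrary \<open>v\<close>.\<close>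

lemma coeff_sum_site_op_op_prod:
  fixes js :: "'n::{finite,linorder} list" and v :: "('N::finite, 'n) tensor"
  assumes "sorted js" "distinct js" "i \<notin> set js"
    and "\<And>j. j \<in> set js \<Longrightarrow> y j \<noteq> 0" "\<And>j. j \<in> set js \<Longrightarrow> y j + \<eta> \<noteq> 0"
  shows "(\<Prod>j\<in>set js. 1 + \<eta> / y j)
      * coeff_sum (site_op A i (op_prod (map (\<lambda>j. R_op \<eta> i j (y j)) (rev js)) v))
    = coeff_sum (site_op A i v)
      + (\<Sum>k\<in>set js. \<eta> / y k * (\<Prod>m\<in>{m\<in>set js. m < k}. 1 + \<eta> / y m)
          * coeff_sum (site_op A k v))"
  using assms
proof (induction js arbitrary: v)
  case Nil
  then show ?case by simp
next
  case (Cons j js)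
  let ?c = "1 + \<eta> / y j"
  let ?\<omega> = "\<lambda>m v. coeff_sum (site_op A m v)"
  let ?w = "R_op \<eta> i j (y j) v"
  have less: "j < k" if "k \<in> set js" for k
    using Cons.prems(1,2) that by (auto simp: order_less_le)
  have j_notin: "j \<notin> set js"
    using Cons.prems(2) by simp
  have y: "y j \<noteq> 0" "y j + \<eta> \<noteq> 0" and "i \<noteq> j"
    using Cons.prems by auto
  have \<omega>_i: "?c * ?\<omega> i ?w = ?\<omega> i v + \<eta> / y j * ?\<omega> j v"
    using coeff_sum_site_op_R_op[OF y, of A i i j v] by simp
  \<comment> \<open>The transposition of \<open>i\<close> and \<open>j\<close> fixes
    \<open>k\<close>, so the two terms merge and R_ij has no effect on omega_k.\<close>
  have \<omega>_k: "?c * ?\<omega> k ?w = ?c * ?\<omega> k v" if "k \<in> set js" for k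
  proof -
    have "i \<noteq> k" "j \<noteq> k"
      using that less[OF that] Cons.prems(3) by auto
    then have "Transposition.transpose i j k = k"
      by simp
    with coeff_sum_site_op_R_op[OF y, of A k i j v] show ?thesis
      by (simp add: algebra_simps)
  qed
  have below: "(\<Prod>m\<in>{m\<in>set (j # js). m < k}. 1 + \<eta> / y m)
      = ?c * (\<Prod>m\<in>{m\<in>set js. m < k}. 1 + \<eta> / y m)" if "k \<in> set js" for k
  proof -
    have "{m\<in>set (j # js). m < k} = insert j {m\<in>set js. m < k}"
      using less[OF that] by auto
    then show ?thesis
      using Cons.prems(2) by simp
  qed
  have below_j: "{m\<in>set (j # js). m < j} = {}"
    using less by force
  have "(\<Prod>j\<in>set (j # js). 1 + \<eta> / y j)
      * ?\<omega> i (op_prod (map (\<lambda>j. R_op \<eta> i j (y j)) (rev (j # js))) v)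
    = ?c * ((\<Prod>j\<in>set js. 1 + \<eta> / y j)
      * ?\<omega> i (op_prod (map (\<lambda>j. R_op \<eta> i j (y j)) (rev js)) ?w))"
    using Cons.prems(2) by (simp add: op_prod_snoc)
  also have "\<dots> = ?c * (?\<omega> i ?w
      + (\<Sum>k\<in>set js. \<eta> / y k * (\<Prod>m\<in>{m\<in>set js. m < k}. 1 + \<eta> / y m) * ?\<omega> k ?w))"
    using Cons.prems by (subst Cons.IH) auto
  also have "\<dots> = ?c * ?\<omega> i ?w
      + (\<Sum>k\<in>set js. \<eta> / y k * (\<Prod>m\<in>{m\<in>set js. m < k}. 1 + \<eta> / y m) * (?c * ?\<omega> k ?w))"
    by (simp only: distrib_left[of ?c] sum_distrib_left mult.left_commute)
  also have "\<dots> = ?\<omega> i v + \<eta> / y j * ?\<omega> j v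
      + (\<Sum>k\<in>set js. \<eta> / y k * (?c * (\<Prod>m\<in>{m\<in>set js. m < k}. 1 + \<eta> / y m)) * ?\<omega> k v)"
    unfolding \<omega>_i by (simp only: \<omega>_k ac_simps cong: sum.cong)
  also have "\<dots> = ?\<omega> i v + \<eta> / y j * ?\<omega> j v
      + (\<Sum>k\<in>set js. \<eta> / y k * (\<Prod>m\<in>{m\<in>set (j # js). m < k}. 1 + \<eta> / y m) * ?\<omega> k v)"
    by (simp only: below cong: sum.cong)
  also have "\<dots> = ?\<omega> i v + (\<Sum>k\<in>set (j # js).
      \<eta> / y k * (\<Prod>m\<in>{m\<in>set (j # js). m < k}. 1 + \<eta> / y m) * ?\<omega> k v)"
    using j_notin below_j by (simp only: list.set(2)[of j js] sum.insert[OF finite_set]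
        prod.empty mult_1_right add.assoc not_False_eq_True)
  finally show ?case .
qed

section \<open>The qKZ operators and their weighted sum\<close>

lemma coeff_sum_qKZ_op:
  fixes x :: "(complex, 'n::{finite,linorder}) vec"
  assumes "general_position \<eta> x" "general_position \<eta> (shift (\<eta> * h) i x)"
  shows "(\<Prod>j\<in>{i<..}. 1 + \<eta> / (x $ i - x $ j)) * coeff_sum (qKZ_op \<eta> h A i x v)
    = coeff_sum (site_op A i v)
      + (\<Sum>k\<in>{i<..}. \<eta> / (x $ i - x $ k) * (\<Prod>m\<in>{i<..<k}. 1 + \<eta> / (x $ i - x $ m))
          * coeff_sum (site_op A k v))"
proof -
  \<comment> \<open>Here x_i - x_j + eta hbar is a coordinate difference of the shifted point, so it
    is general position there that keeps the denominator nonzero.\<close>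
  have left: "x $ i - x $ j + \<eta> * h + \<eta> \<noteq> 0" if "j < i" for j
  proof -
    have "i \<noteq> j"
      using that by simp
    with assms(2) have "shift (\<eta> * h) i x $ i \<noteq> shift (\<eta> * h) i x $ j - \<eta>"
      unfolding general_position_def by blast
    with \<open>i \<noteq> j\<close> show ?thesis
      by (auto simp: shift_def algebra_simps)
  qed
  have right: "x $ i - x $ j \<noteq> 0" "x $ i - x $ j + \<eta> \<noteq> 0" if "i < j" for j
  proof -
    have "i \<noteq> j" using that by simp
    with assms(1) have "x $ i \<noteq> x $ j" "x $ i \<noteq> x $ j - \<eta>"
      by (auto simp: general_position_def)
    then show "x $ i - x $ j \<noteq> 0" "x $ i - x $ j + \<eta> \<noteq> 0"
      by (auto simp: algebra_simps)
  qed
  let ?L = "op_prod (map (\<lambda>j. R_op \<eta> i j (x $ i - x $ j + \<eta> * h)) (rev (sorted_list_of_set {..<i})))"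
  let ?R = "op_prod (map (\<lambda>j. R_op \<eta> i j (x $ i - x $ j)) (rev (sorted_list_of_set {i<..})))"
  have "coeff_sum (qKZ_op \<eta> h A i x v) = coeff_sum (?L (site_op A i (?R v)))"
    by (simp add: qKZ_op_def)
  also have "\<dots> = coeff_sum (site_op A i (?R v))"
    by (rule coeff_sum_op_prod_R_op) (simp add: left)
  finally have drop_left: "coeff_sum (qKZ_op \<eta> h A i x v) = coeff_sum (site_op A i (?R v))" .
  have between: "{m \<in> {i<..}. m < k} = {i<..<k}" for k
    by auto
  have set: "set (sorted_list_of_set {i<..}) = {i<..}"
    by simp
  show ?thesis
    unfolding drop_left
    by (rule coeff_sum_site_op_op_prod[of "sorted_list_of_set {i<..}", unfolded set between])
      (auto dest: right)
qed

lemma sum_coeff_sum_qKZ_op: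
  fixes x :: "(complex, 'n::{finite,linorder}) vec"
  assumes gp: "general_position \<eta> x" "\<And>i. general_position \<eta> (shift (\<eta> * h) i x)"
  shows "(\<Sum>i\<in>UNIV. (\<Prod>j\<in>UNIV - {i}. (x $ i - x $ j + \<eta>) / (x $ i - x $ j))
            * coeff_sum (qKZ_op \<eta> h A i x v))
    = (\<Sum>k\<in>UNIV. coeff_sum (site_op A k v))"
proof -
  let ?F = "\<lambda>i S. \<Prod>j\<in>S. 1 + \<eta> / (x $ i - x $ j)"
  let ?\<omega> = "\<lambda>m. coeff_sum (site_op A m v)"
  let ?q = "\<lambda>i. coeff_sum (qKZ_op \<eta> h A i x v)"
  have x_eq_iff: "x $ i = x $ j \<longleftrightarrow> i = j" for i j
    using gp(1) by (auto simp: general_position_def)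
  \<comment> \<open>The half with j > i is exactly the prefactor in \<open>coeff_sum_qKZ_op\<close>;
    the half with j < i is left over.\<close>
  have weight: "(\<Prod>j\<in>UNIV - {i}. (x $ i - x $ j + \<eta>) / (x $ i - x $ j))
      = ?F i {..<i} * ?F i {i<..}" for i
  proof -
    have split: "UNIV - {i} = {..<i} \<union> {i<..}"
      by auto
    have "(\<Prod>j\<in>UNIV - {i}. (x $ i - x $ j + \<eta>) / (x $ i - x $ j)) = ?F i (UNIV - {i})"
      by (intro prod.cong refl) (auto simp: add_divide_distrib x_eq_iff)
    then show ?thesis
      unfolding split by (subst (asm) (2) prod.union_disjoint) auto
  qed
  \<comment> \<open>The leftover half and the factors picked up between \<open>i\<close> and
    \<open>k\<close> combine to the residue product over all indices below \<open>k\<close> other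
    than \<open>i\<close>.\<close>
  have join: "?F i {..<i} * ?F i {i<..<k} = ?F i ({..<k} - {i})" if "i < k" for i k
  proof -
    have split: "{..<k} - {i} = {..<i} \<union> {i<..<k}"
      using that by auto
    show ?thesis
      unfolding split by (rule prod.union_disjoint[symmetric]) auto
  qed
  \<comment> \<open>The total coefficient of omega_k: the expansion with \<open>S = {..<k}\<close>
    and \<open>y = x $ k\<close>, whose pole terms cancel because the denominators here have the
    opposite sign.\<close>
  have coefficient: "?F k {..<k}
      + (\<Sum>i\<in>{..<k}. \<eta> / (x $ i - x $ k) * ?F i ({..<k} - {i})) = 1" for k
  proof -
    have "\<eta> / (x $ i - x $ k) = - (\<eta> / (x $ k - x $ i))" for i
      by (metis minus_diff_eq minus_divide_right)
    moreover have "?F k {..<k}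
        = 1 + (\<Sum>i\<in>{..<k}. \<eta> / (x $ k - x $ i) * ?F i ({..<k} - {i}))"
      by (rule prod_one_plus_inverse_partial_fractions) (auto simp: inj_on_def x_eq_iff)
    ultimately show ?thesis
      by (simp add: sum_negf)
  qed
  have "(\<Sum>i\<in>UNIV. (\<Prod>j\<in>UNIV - {i}. (x $ i - x $ j + \<eta>) / (x $ i - x $ j)) * ?q i)
      = (\<Sum>i\<in>UNIV. ?F i {..<i} * (?\<omega> i
          + (\<Sum>k\<in>{i<..}. \<eta> / (x $ i - x $ k) * ?F i {i<..<k} * ?\<omega> k)))"
    by (simp add: weight mult.assoc coeff_sum_qKZ_op[OF gp])
  also have "\<dots> = (\<Sum>k\<in>UNIV. ?F k {..<k} * ?\<omega> k)
      + (\<Sum>i\<in>UNIV. \<Sum>k\<in>{i<..}. \<eta> / (x $ i - x $ k) * ?F i ({..<k} - {i}) * ?\<omega> k)"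
    by (simp add: distrib_left sum.distrib sum_distrib_left join[symmetric] mult_ac)
  \<comment> \<open>Both sides run over the pairs i < k; summing over \<open>i\<close> first
    collects the coefficient of each omega_k.\<close>
  also have "(\<Sum>i\<in>UNIV. \<Sum>k\<in>{i<..}. \<eta> / (x $ i - x $ k) * ?F i ({..<k} - {i}) * ?\<omega> k)
      = (\<Sum>k\<in>UNIV. \<Sum>i\<in>{..<k}. \<eta> / (x $ i - x $ k) * ?F i ({..<k} - {i}) * ?\<omega> k)"
    using sum.swap_restrict[of UNIV UNIV
        "\<lambda>i k. \<eta> / (x $ i - x $ k) * ?F i ({..<k} - {i}) * ?\<omega> k" "(<)"]
    by (simp add: greaterThan_def lessThan_def)
  also have "(\<Sum>k\<in>UNIV. ?F k {..<k} * ?\<omega> k) + \<dots>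
      = (\<Sum>k\<in>UNIV. (?F k {..<k}
          + (\<Sum>i\<in>{..<k}. \<eta> / (x $ i - x $ k) * ?F i ({..<k} - {i}))) * ?\<omega> k)"
    by (simp add: sum.distrib distrib_right sum_distrib_right)
  finally show ?thesis
    by (simp only: coefficient mult_1_left)
qed

section \<open>Weight subspaces and the eigenvalue\<close>

lemma weight_space_nth_eq_0:
  assumes "v \<in> weight_space M" "J \<notin> multi_indices M"
  shows "v $ J = 0"
  using assms(1) unfolding weight_space_def
proof (induction rule: vec.span_induct_alt)
  case base
  then show ?case by simp
next
  case (step c w u)
  then show ?case
    using assms(2) by (auto simp: ket_def axis_def split: if_splits)
qed

lemma coeff_sum_weight_space:
  assumes "v \<in> weight_space M"
  shows "coeff_sum v = (\<Sum>J\<in>multi_indices M. v $ J)"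
  unfolding coeff_sum_def
  by (rule sum.mono_neutral_right) (auto simp: weight_space_nth_eq_0[OF assms])

lemma site_op_diag_matrix: "site_op (diag_matrix g) i v $ J = g (J i) * v $ J"
  by (simp add: site_op_def diag_matrix_def if_distrib[where f = "\<lambda>z. z * _"] cong: if_cong)

text \<open>Group the sites by the value that \<open>J\<close> takes there; the value
  \<open>a\<close> occurs \<open>M a\<close> times.\<close>

lemma sum_multi_index:
  fixes J :: "'n::finite \<Rightarrow> 'N::finite" and g :: "'N \<Rightarrow> 'a::comm_semiring_1"
  assumes "J \<in> multi_indices M"
  shows "(\<Sum>k\<in>UNIV. g (J k)) = (\<Sum>a\<in>UNIV. of_nat (M a) * g a)"
proof -
  have "(\<Sum>k\<in>UNIV. g (J k)) = (\<Sum>a\<in>UNIV. \<Sum>k\<in>{k\<in>UNIV. J k = a}. g (J k))"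
    by (intro sum.group[symmetric]) auto
  also have "\<dots> = (\<Sum>a\<in>UNIV. of_nat (M a) * g a)"
    using assms by (intro sum.cong refl) (simp add: multi_indices_def)
  finally show ?thesis .
qed

text \<open>The sum of all g^(k) is diagonal with eigenvalue \<open>\<Sum>k. g (J k)\<close> on
  \<open>ket J\<close>. This is the same number for every \<open>J\<close> of the given weight, and
  the other coefficients of \<open>v\<close> vanish.\<close>

lemma sum_coeff_sum_site_op_diag:
  assumes "v \<in> weight_space M"
  shows "(\<Sum>k\<in>UNIV. coeff_sum (site_op (diag_matrix g) k v))
    = (\<Sum>a\<in>UNIV. of_nat (M a) * g a) * coeff_sum v"
proof -
  have "(\<Sum>k\<in>UNIV. coeff_sum (site_op (diag_matrix g) k v))
      = (\<Sum>J\<in>UNIV. (\<Sum>k\<in>UNIV. g (J k)) * v $ J)"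
    unfolding coeff_sum_def site_op_diag_matrix
    by (subst sum.swap) (simp add: sum_distrib_right)
  also have "\<dots> = (\<Sum>J\<in>UNIV. (\<Sum>a\<in>UNIV. of_nat (M a) * g a) * v $ J)"
  proof (intro sum.cong refl)
    fix J
    show "(\<Sum>k\<in>UNIV. g (J k)) * v $ J = (\<Sum>a\<in>UNIV. of_nat (M a) * g a) * v $ J"
      by (cases "J \<in> multi_indices M")
        (simp_all add: sum_multi_index weight_space_nth_eq_0[OF assms])
  qed
  finally show ?thesis
    by (simp add: coeff_sum_def sum_distrib_left)
qed

theorem mainTheorem1:
  fixes \<eta> h :: complex
    and g :: "'N::finite \<Rightarrow> complex"
    and M :: "'N \<Rightarrow> nat"
    and X :: "(complex, 'n::{finite,linorder}) vec set"
    and \<Phi> :: "(complex, 'n) vec \<Rightarrow> ('N, 'n) tensor"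
    and \<Psi> :: "(complex, 'n) vec \<Rightarrow> complex"
    and E :: complex
  assumes "invertible (diag_matrix g)"
    and "(\<Sum>a\<in>UNIV. M a) = CARD('n)"
    and "\<And>x i. x \<in> X \<Longrightarrow> shift (\<eta> * h) i x \<in> X"
    and "\<And>x. x \<in> X \<Longrightarrow> general_position \<eta> x"
    and "\<And>x. x \<in> X \<Longrightarrow> \<Phi> x \<in> weight_space M"
    and "qKZ_solution \<eta> h (diag_matrix g) X \<Phi>"
    and "\<And>x. x \<in> X \<Longrightarrow> \<Psi> x = (\<Sum>J\<in>multi_indices M. \<Phi> x $ J)"
    and "E = (\<Sum>a\<in>UNIV. of_nat (M a) * g a)"
  shows "\<forall>x\<in>X. (\<Sum>i\<in>UNIV. (\<Prod>j\<in>UNIV - {i}. (x $ i - x $ j + \<eta>) / (x $ i - x $ j))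
            * \<Psi> (shift (\<eta> * h) i x))
          = E * \<Psi> x"
proof
  fix x
  assume x: "x \<in> X"
  \<comment> \<open>Stated for every point of \<open>X\<close>, since it is applied both at
    \<open>x\<close> and at its shifts, which remain in \<open>X\<close>.\<close>
  have \<Psi>: "\<Psi> y = coeff_sum (\<Phi> y)" if "y \<in> X" for y
    using that assms(5,7) by (simp add: coeff_sum_weight_space[of _ M])
  have "\<Psi> (shift (\<eta> * h) i x) = coeff_sum (qKZ_op \<eta> h (diag_matrix g) i x (\<Phi> x))" for i
    using \<Psi> assms(3,6) x by (simp add: qKZ_solution_def)
  then show "(\<Sum>i\<in>UNIV. (\<Prod>j\<in>UNIV - {i}. (x $ i - x $ j + \<eta>) / (x $ i - x $ j))
      * \<Psi> (shift (\<eta> * h) i x)) = E * \<Psi> x"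
    using assms(3,4,5,8) x
    by (simp add: sum_coeff_sum_qKZ_op sum_coeff_sum_site_op_diag[of _ M] \<Psi>)
qed

end
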